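(* (Degree-decrease recurrence.) Let $\{Q_p(x)\}_{p\ge 0}$ be a sequence of orthogonal polynomials given by a Favard recurrence $Q_{p+1}(x)=(A_px+B_p)Q_p(x)-C_pQ_{p-1}(x)$, $p\ge 0$, $Q_0(x)=1$, $Q_{-1}(x)=0$, with coefficients as in the context. Let $p,s,t$ be integers with $1\le t\le p$ and $s\ge 1$, and let $\Psi_{p+s}^{(p)},\Psi_{p+s}^{(p-1)},\psi_{p-t}^{(p)},\psi_{p-t}^{(p-1)}$ be the coefficient functions defined in the context. Then for every real $x$ with $\Psi_{p+s}^{(p-1)}(x)\neq 0$ and $\psi_{p-t}^{(p-1)}(x)\ne 0$, $$Q_{p-t}(x)=\hat M(x)Q_{p+s}(x)+\hat N(x)Q_{p}(x),$$ where $$\hat M(x)=\frac{\psi_{p-t}^{(p-1)}(x)}{\Psi_{p+s}^{(p-1)}(x)},\qquad \hat N(x)=-\frac{\det(\mathbf K)}{\Psi_{p+s}^{(p-1)}(x)},\qquad \mathbf K=\begin{bmatrix}\Psi_{p+s}^{(p)}(x)&\Psi_{p+s}^{(p-1)}(x)\\ \psi_{p-t}^{(p)}(x)&\psi_{p-t}^{(p-1)}(x)\end{bmatrix}.$$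
   Context: Favard coefficients: $(A_p)_{p\ge0},(B_p)_{p\ge0},(C_p)_{p\ge 0}$ are real sequences with $A_p\ne0$ for all $p\ge 0$, and $C_p\neq 0$ and $C_pA_pA_{p-1}>0$ for all $p\ge 1$ ($C_0$ is irrelevant since $Q_{-1}=0$). Notation: for $i\ge 1$, $S_i(x)=A_ix+B_i$, $T_i(x)=S_i(x)/C_i$, $D_i=1/C_i$. Degree-increase coefficients: for fixed $p\ge1$, the functions $\Psi_{p+s}^{(p)},\Psi_{p+s}^{(p-1)}$ ($s\ge1$) are defined by $\Psi_{p+1}^{(p)}(x)=S_p(x)$, $\Psi_{p+1}^{(p-1)}(x)=-C_p$; $\Psi_{p+2}^{(p)}(x)=S_{p+1}(x)S_p(x)-C_{p+1}$, $\Psi_{p+2}^{(p-1)}(x)=-C_pS_{p+1}(x)$; and for $s\ge3$ and each $j\in\{p,p-1\}$, $\Psi_{p+s}^{(j)}(x)=S_{p+s-1}(x)\Psi_{p+s-1}^{(j)}(x)-C_{p+s-1}\Psi_{p+s-2}^{(j)}(x)$. Degree-decrease coefficients: for fixed $p\ge1$, the functions $\psi_{p-t}^{(p)},\psi_{p-t}^{(p-1)}$ ($1\le t\le p$) are defined by $\psi_{p-1}^{(p)}(x)=0$, $\psi_{p-1}^{(p-1)}(x)=1$; $\psi_{p-2}^{(p)}(x)=-D_{p-1}$, $\psi_{p-2}^{(p-1)}(x)=T_{p-1}(x)$; and for $t\ge3$ and each $j\in\{p,p-1\}$, $\psi_{p-t}^{(j)}(x)=T_{p-t+1}(x)\psi_{p-t+1}^{(j)}(x)-D_{p-t+1}\psi_{p-t+2}^{(j)}(x)$.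 *)

theory Defs
  imports "HOL-Analysis.Analysis" "HOL-Computational_Algebra.Polynomial"
begin

(* The sign condition is the positive-definiteness hypothesis of Favard's theorem: together with
   the recurrence below it makes (Q p) orthogonal with respect to some positive measure, so
   orthogonality is not a separate hypothesis.  C 0 is unconstrained. *)
definition favard_coeffs :: "(nat \<Rightarrow> real) \<Rightarrow> (nat \<Rightarrow> real) \<Rightarrow> bool" where
  "favard_coeffs A C \<longleftrightarrow>
     (\<forall>p. A p \<noteq> 0) \<and> (\<forall>p\<ge>1. C p \<noteq> 0 \<and> C p * A p * A (p - 1) > 0)"

(* The conditional encodes Q (-1) = 0. *)
definition favard_sequence ::
    "(nat \<Rightarrow> real) \<Rightarrow> (nat \<Rightarrow> real) \<Rightarrow> (nat \<Rightarrow> real) \<Rightarrow> (nat \<Rightarrow> real poly) \<Rightarrow> bool" where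
  "favard_sequence A B C Q \<longleftrightarrow>
     Q 0 = 1 \<and>
     (\<forall>p. Q (p + 1) = [:B p, A p:] * Q p - smult (C p) (if p = 0 then 0 else Q (p - 1)))"

definition S :: "(nat \<Rightarrow> real) \<Rightarrow> (nat \<Rightarrow> real) \<Rightarrow> nat \<Rightarrow> real \<Rightarrow> real" where
  "S A B i x = A i * x + B i"

definition T :: "(nat \<Rightarrow> real) \<Rightarrow> (nat \<Rightarrow> real) \<Rightarrow> (nat \<Rightarrow> real) \<Rightarrow> nat \<Rightarrow> real \<Rightarrow> real" where
  "T A B C i x = S A B i x / C i"

definition D :: "(nat \<Rightarrow> real) \<Rightarrow> nat \<Rightarrow> real" where
  "D C i = 1 / C i"

(* Psi_hi A B C p s and Psi_lo A B C p s are the functions Psi_{p+s} with upper index p and p-1,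
   respectively; psi_hi A B C p t and psi_lo A B C p t are psi_{p-t} with upper index p and p-1.
   They are meant for p \<ge> 1, s \<ge> 1 and 1 \<le> t \<le> p; the value at s = 0 or t = 0 is a dummy. *)

fun Psi_hi :: "(nat \<Rightarrow> real) \<Rightarrow> (nat \<Rightarrow> real) \<Rightarrow> (nat \<Rightarrow> real) \<Rightarrow> nat \<Rightarrow> nat \<Rightarrow> real \<Rightarrow> real" where
  "Psi_hi A B C p 0 x = 0"
| "Psi_hi A B C p (Suc 0) x = S A B p x"
| "Psi_hi A B C p (Suc (Suc 0)) x = S A B (p + 1) x * S A B p x - C (p + 1)"
| "Psi_hi A B C p (Suc (Suc (Suc n))) x =
     S A B (p + n + 2) x * Psi_hi A B C p (Suc (Suc n)) x - C (p + n + 2) * Psi_hi A B C p (Suc n) x"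

fun Psi_lo :: "(nat \<Rightarrow> real) \<Rightarrow> (nat \<Rightarrow> real) \<Rightarrow> (nat \<Rightarrow> real) \<Rightarrow> nat \<Rightarrow> nat \<Rightarrow> real \<Rightarrow> real" where
  "Psi_lo A B C p 0 x = 0"
| "Psi_lo A B C p (Suc 0) x = - C p"
| "Psi_lo A B C p (Suc (Suc 0)) x = - C p * S A B (p + 1) x"
| "Psi_lo A B C p (Suc (Suc (Suc n))) x =
     S A B (p + n + 2) x * Psi_lo A B C p (Suc (Suc n)) x - C (p + n + 2) * Psi_lo A B C p (Suc n) x"

(* In the recursive equations t = n + 3, so the index p - t + 1 is p - (n + 2). *)
fun psi_hi :: "(nat \<Rightarrow> real) \<Rightarrow> (nat \<Rightarrow> real) \<Rightarrow> (nat \<Rightarrow> real) \<Rightarrow> nat \<Rightarrow> nat \<Rightarrow> real \<Rightarrow> real" where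
  "psi_hi A B C p 0 x = 0"
| "psi_hi A B C p (Suc 0) x = 0"
| "psi_hi A B C p (Suc (Suc 0)) x = - D C (p - 1)"
| "psi_hi A B C p (Suc (Suc (Suc n))) x =
     T A B C (p - (n + 2)) x * psi_hi A B C p (Suc (Suc n)) x
       - D C (p - (n + 2)) * psi_hi A B C p (Suc n) x"

fun psi_lo :: "(nat \<Rightarrow> real) \<Rightarrow> (nat \<Rightarrow> real) \<Rightarrow> (nat \<Rightarrow> real) \<Rightarrow> nat \<Rightarrow> nat \<Rightarrow> real \<Rightarrow> real" where
  "psi_lo A B C p 0 x = 0"
| "psi_lo A B C p (Suc 0) x = 1"
| "psi_lo A B C p (Suc (Suc 0)) x = T A B C (p - 1) x"
| "psi_lo A B C p (Suc (Suc (Suc n))) x =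
     T A B C (p - (n + 2)) x * psi_lo A B C p (Suc (Suc n)) x
       - D C (p - (n + 2)) * psi_lo A B C p (Suc n) x"

definition K_mat ::
    "(nat \<Rightarrow> real) \<Rightarrow> (nat \<Rightarrow> real) \<Rightarrow> (nat \<Rightarrow> real) \<Rightarrow> nat \<Rightarrow> nat \<Rightarrow> nat \<Rightarrow> real \<Rightarrow> real^2^2" where
  "K_mat A B C p s t x =
     vector [vector [Psi_hi A B C p s x, Psi_lo A B C p s x],
             vector [psi_hi A B C p t x, psi_lo A B C p t x]]"

definition M_hat ::
    "(nat \<Rightarrow> real) \<Rightarrow> (nat \<Rightarrow> real) \<Rightarrow> (nat \<Rightarrow> real) \<Rightarrow> nat \<Rightarrow> nat \<Rightarrow> nat \<Rightarrow> real \<Rightarrow> real" where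
  "M_hat A B C p s t x = psi_lo A B C p t x / Psi_lo A B C p s x"

definition N_hat ::
    "(nat \<Rightarrow> real) \<Rightarrow> (nat \<Rightarrow> real) \<Rightarrow> (nat \<Rightarrow> real) \<Rightarrow> nat \<Rightarrow> nat \<Rightarrow> nat \<Rightarrow> real \<Rightarrow> real" where
  "N_hat A B C p s t x = - (det (K_mat A B C p s t x) / Psi_lo A B C p s x)"

end

theory Submission
  imports Defs
begin

text \<open>At a fixed \<open>x\<close> the Favard recurrence is a second-order linear recurrence for the values
  \<open>q k = poly (Q k) x\<close>, so any two consecutive values determine all others linearly.  The \<open>\<Psi>\<close> are the
  coefficients of \<open>q (p + s)\<close> in terms of \<open>q p\<close> and \<open>q (p - 1)\<close> (running the recurrence upwards,
  lemma \<open>Psi_expansion\<close>), the \<open>\<psi>\<close> those of \<open>q (p - t)\<close> (running it downwards, which divides by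
  \<open>C k \<noteq> 0\<close>, lemma \<open>psi_expansion\<close>).  Together they say that the matrix \<open>K\<close> sends
  \<open>(q p, q (p - 1))\<close> to \<open>(q (p + s), q (p - t))\<close>; eliminating \<open>q (p - 1)\<close> between the two
  equations, where its coefficient in the first is nonzero, gives the identity.\<close>

lemma favard_sequence_eval:
  assumes "favard_sequence A B C Q" and "1 \<le> k"
  shows "poly (Q (Suc k)) x = S A B k x * poly (Q k) x - C k * poly (Q (k - 1)) x"
proof -
  have "Q (k + 1) = [:B k, A k:] * Q k - smult (C k) (Q (k - 1))"
    using assms unfolding favard_sequence_def by auto
  then have "poly (Q (k + 1)) x = poly ([:B k, A k:] * Q k - smult (C k) (Q (k - 1))) x"
    by simp
  then show ?thesis
    by (simp add: S_def algebra_simps)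
qed

text \<open>Both sides obey the same two-step recurrence in \<open>s\<close>.  The coefficient functions are
  dummies at \<open>s = 0\<close>, hence the shift to \<open>Suc n\<close>.\<close>

lemma Psi_expansion:
  assumes rec: "\<And>k. 1 \<le> k \<Longrightarrow> q (Suc k) = S A B k x * q k - C k * q (k - 1)"
    and p: "1 \<le> p"
  shows "q (p + Suc n) = Psi_hi A B C p (Suc n) x * q p + Psi_lo A B C p (Suc n) x * q (p - 1)"
proof (induction n rule: induct_nat_012)
  case 0
  then show ?case using rec[of p] p by simp
next
  case 1
  have "q (Suc (Suc p)) = S A B (Suc p) x * q (Suc p) - C (Suc p) * q p"
    using rec[of "Suc p"] by simp
  also have "q (Suc p) = S A B p x * q p - C p * q (p - 1)"
    using rec[OF p] .
  finally show ?case by (simp add: algebra_simps)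
next
  case (ge2 n)
  have "q (p + Suc (Suc (Suc n))) =
      S A B (p + n + 2) x * q (p + Suc (Suc n)) - C (p + n + 2) * q (p + Suc n)"
    using rec[of "p + n + 2"] by simp
  then show ?case
    unfolding ge2 by (simp add: algebra_simps)
qed

lemma psi_expansion:
  assumes rec: "\<And>k. 1 \<le> k \<Longrightarrow> q (Suc k) = S A B k x * q k - C k * q (k - 1)"
    and C: "\<And>k. 1 \<le> k \<Longrightarrow> C k \<noteq> 0"
    and "Suc n \<le> p"
  shows "q (p - Suc n) = psi_hi A B C p (Suc n) x * q p + psi_lo A B C p (Suc n) x * q (p - 1)"
proof -
  have down: "q (k - 1) = T A B C k x * q k - D C k * q (Suc k)" if "1 \<le> k" for k
    using rec[OF that] C[OF that] by (simp add: T_def D_def field_simps)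
  show ?thesis
    using \<open>Suc n \<le> p\<close>
  proof (induction n rule: induct_nat_012)
    case 0
    then show ?case by simp
  next
    case 1
    then have "Suc (p - 1) = p" "p - 1 - 1 = p - Suc (Suc 0)" by auto
    then show ?case using down[of "p - 1"] 1 by simp
  next
    case (ge2 n)
    have idx: "p - (n + 2) = p - Suc (Suc n)" "Suc (p - (n + 2)) = p - Suc n"
      "p - (n + 2) - 1 = p - Suc (Suc (Suc n))"
      using ge2.prems by auto
    have "q (p - Suc (Suc (Suc n))) =
        T A B C (p - (n + 2)) x * q (p - Suc (Suc n)) - D C (p - (n + 2)) * q (p - Suc n)"
      using down[of "p - (n + 2)"] ge2.prems unfolding idx(2,3) unfolding idx(1) by simp
    moreover have "q (p - Suc n) =
        psi_hi A B C p (Suc n) x * q p + psi_lo A B C p (Suc n) x * q (p - 1)"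
      "q (p - Suc (Suc n)) =
        psi_hi A B C p (Suc (Suc n)) x * q p + psi_lo A B C p (Suc (Suc n)) x * q (p - 1)"
      using ge2 by simp_all
    ultimately show ?case
      by (simp only: psi_hi.simps psi_lo.simps) (simp add: algebra_simps)
  qed
qed

theorem mainTheorem4:
  fixes A B C :: "nat \<Rightarrow> real" and Q :: "nat \<Rightarrow> real poly"
    and p s t :: nat and x :: real
  assumes "favard_coeffs A C"
    and "favard_sequence A B C Q"
    and "1 \<le> t" and "t \<le> p" and "1 \<le> s"
    and "Psi_lo A B C p s x \<noteq> 0"
    and "psi_lo A B C p t x \<noteq> 0"
  shows "poly (Q (p - t)) x =
           M_hat A B C p s t x * poly (Q (p + s)) x + N_hat A B C p s t x * poly (Q p) x"
proof -
  define q where "q k = poly (Q k) x" for k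
  have rec: "q (Suc k) = S A B k x * q k - C k * q (k - 1)" if "1 \<le> k" for k
    unfolding q_def using favard_sequence_eval[OF assms(2) that] .
  have C: "C k \<noteq> 0" if "1 \<le> k" for k
    using assms(1) that unfolding favard_coeffs_def by blast
  have up: "q (p + s) = Psi_hi A B C p s x * q p + Psi_lo A B C p s x * q (p - 1)"
    using Psi_expansion[of q A B x C p "s - 1", OF rec] assms by simp
  have dn: "q (p - t) = psi_hi A B C p t x * q p + psi_lo A B C p t x * q (p - 1)"
    using psi_expansion[of q A B x C "t - 1" p, OF rec C] assms by simp
  have det: "det (K_mat A B C p s t x) =
      Psi_hi A B C p s x * psi_lo A B C p t x - Psi_lo A B C p s x * psi_hi A B C p t x"
    by (simp add: K_mat_def det_2)
  have "q (p - t) = M_hat A B C p s t x * q (p + s) + N_hat A B C p s t x * q p"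
    unfolding up dn M_hat_def N_hat_def det using assms(6) by (simp add: field_simps)
  then show ?thesis
    unfolding q_def .
qed

end
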